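(* Let $n\ge2$, $\gamma>0$, and let $Cone_\Sigma\subset\mathbb{R}^n$ be a $C^{1,1}$ epigraphical cone with norms $(L,K)$ whose frequency $\phi=\phi_\Sigma$ satisfies $\phi=\frac{2}{1+\gamma}$. Let $\Omega=Cone_\Sigma\cap B_1$, let $U$ be the solution of $-\Delta U=U^{-\gamma}$ in $\Omega$, $U=0$ on $\partial\Omega$, and for $k\ge1$ let $p_k=\frac{16^{1-k}}{2}\vec e_n$ and $a_k=16^{k\phi}U(p_k)$. Then $a_1\sim1$ and $a_{k+1}\ge a_k$ for every $k\ge1$.
   Context: $B_r$ is the open ball of radius $r$ centered at $0$ in $\mathbb{R}^n$; points are written $x=(x',x_n)$, $B_r'$ is the ball in $\mathbb{R}^{n-1}$, and $\vec e_n$ is the $n$-th unit vector. Cones: for $\Sigma\subseteq\partial B_1=\mathbb{S}^{n-1}$, $Cone_\Sigma=\{x\in\mathbb{R}^n\setminus\{0\}: x/|x|\in\Sigma\}$. It is a $C^{1,1}$ epigraphical cone if $Cone_\Sigma=\{x_n>g(x')\}$ for some $g:\mathbb{R}^{n-1}\to\mathbb{R}$ with $g(\lambda x')=\lambda g(x')$ for all $\lambda\ge0$, and $g\in C^{1,1}(B_2'\setminus B_1')$. Its norms are $L=\|g\|_{C^{0,1}(B_2'\setminus B_1')}$ and $K=[g]_{C^{1,1}(B_2'\setminus B_1')}$. Frequency: let $\lambda_\Sigma$ be the first Dirichlet eigenvalue of the Laplace-Beltrami operator $-\Delta_\Sigma$ on $\Sigma$; the frequency $\phi_\Sigma$ is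 the positive solution of $\phi(\phi+n-2)=\lambda_\Sigma$. $q_1\sim q_2$ means $C^{-1}q_2\le q_1\le Cq_2$ for a constant $C>0$ depending only on $(n,\gamma,L,K)$. $U$ is the unique positive function in $C^\infty(\Omega)\cap C(\overline\Omega)$ solving the Dirichlet problem. *)

theory Defs
  imports "HOL-Analysis.Analysis"
begin

text \<open>
  Points \<open>x = (x', x\<^sub>n)\<close> of \<open>\<real>\<^sup>n\<close>, \<open>n \<ge> 2\<close>, are elements of \<^typ>\<open>(real ^ 'm) \<times> real\<close>, so that
  \<open>n = CARD('m) + 1\<close>. The library norm on this product is the Euclidean one.
\<close>

definition e_n :: "(real ^ 'm) \<times> real"
  where "e_n = (0, 1)"

text \<open>The sets \<open>S\<close> to which the next definition is applied are open.\<close>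

primrec Ck_on :: "nat \<Rightarrow> 'a::real_normed_vector set \<Rightarrow> ('a \<Rightarrow> real) \<Rightarrow> bool"
  where
    "Ck_on 0 S f \<longleftrightarrow> continuous_on S f"
  | "Ck_on (Suc k) S f \<longleftrightarrow>
      (\<forall>x\<in>S. f differentiable (at x)) \<and>
      (\<forall>v. Ck_on k S (\<lambda>x. frechet_derivative f (at x) v))"

definition smooth_on :: "'a::real_normed_vector set \<Rightarrow> ('a \<Rightarrow> real) \<Rightarrow> bool"
  where "smooth_on S f \<longleftrightarrow> (\<forall>k. Ck_on k S f)"

definition gradient :: "('a::euclidean_space \<Rightarrow> real) \<Rightarrow> 'a \<Rightarrow> 'a"
  where "gradient f x = (\<Sum>b\<in>Basis. frechet_derivative f (at x) b *\<^sub>R b)"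

definition laplacian :: "('a::euclidean_space \<Rightarrow> real) \<Rightarrow> 'a \<Rightarrow> real"
  where "laplacian f x =
    (\<Sum>b\<in>Basis. frechet_derivative (\<lambda>y. frechet_derivative f (at y) b) (at x) b)"

text \<open>
  Norms take values in the extended reals, so that the value \<open>\<infinity>\<close> marks functions outside the
  corresponding space; all sets below have at least two points.
\<close>

definition sup_norm :: "'a set \<Rightarrow> ('a \<Rightarrow> 'b::real_normed_vector) \<Rightarrow> ereal"
  where "sup_norm S f = (SUP x\<in>S. ereal (norm (f x)))"

definition lip_seminorm ::
    "'a::real_normed_vector set \<Rightarrow> ('a \<Rightarrow> 'b::real_normed_vector) \<Rightarrow> ereal"
  where "lip_seminorm S f =
    Sup {ereal (norm (f x - f y) / norm (x - y)) | x y. x \<in> S \<and> y \<in> S \<and> x \<noteq> y}"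

definition C01_norm :: "'a::euclidean_space set \<Rightarrow> ('a \<Rightarrow> real) \<Rightarrow> ereal"
  where "C01_norm S f = sup_norm S f + lip_seminorm S f"

definition C11_seminorm :: "'a::euclidean_space set \<Rightarrow> ('a \<Rightarrow> real) \<Rightarrow> ereal"
  where "C11_seminorm S f = lip_seminorm S (gradient f)"

text \<open>
  The set \<open>S\<close> will be the annulus \<open>{1 \<le> |x'| < 2}\<close>, which is not open. Two-sided differentiability at
  \<open>|x'| = 1\<close> is no extra restriction for the functions considered, which are positively homogeneous
  on the whole space.
\<close>

definition C11_on :: "'a::euclidean_space set \<Rightarrow> ('a \<Rightarrow> real) \<Rightarrow> bool"
  where "C11_on S f \<longleftrightarrow>
    (\<forall>x\<in>S. f differentiable (at x)) \<and>
    sup_norm S f + sup_norm S (gradient f) + C11_seminorm S f < \<infinity>"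

definition Cone :: "'a::real_normed_vector set \<Rightarrow> 'a set"
  where "Cone \<Sigma> = {x. x \<noteq> 0 \<and> x /\<^sub>R norm x \<in> \<Sigma>}"

definition C11_epigraphical_cone ::
    "((real ^ 'm) \<times> real) set \<Rightarrow> real \<Rightarrow> real \<Rightarrow> bool"
  where "C11_epigraphical_cone \<Sigma> L K \<longleftrightarrow>
    \<Sigma> \<subseteq> sphere 0 1 \<and>
    (\<exists>g :: real ^ 'm \<Rightarrow> real.
      Cone \<Sigma> = {(x', x\<^sub>n). x\<^sub>n > g x'} \<and>
      (\<forall>t\<ge>0. \<forall>x'. g (t *\<^sub>R x') = t * g x') \<and>
      C11_on (ball 0 2 - ball 0 1) g \<and>
      C01_norm (ball 0 2 - ball 0 1) g = ereal L \<and>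
      C11_seminorm (ball 0 2 - ball 0 1) g = ereal K)"

text \<open>
  Calculus on the unit sphere goes through the extension of \<open>u\<close> that is homogeneous of degree \<open>0\<close>:
  the Laplace-Beltrami operator of the sphere is the restriction to the sphere of the Euclidean
  Laplacian of that extension, and \<open>u\<close> is smooth iff its extension is.
\<close>

definition homogeneous_extension :: "('a::real_normed_vector \<Rightarrow> real) \<Rightarrow> 'a \<Rightarrow> real"
  where "homogeneous_extension u x = u (x /\<^sub>R norm x)"

definition laplace_beltrami :: "('a::euclidean_space \<Rightarrow> real) \<Rightarrow> 'a \<Rightarrow> real"
  where "laplace_beltrami u = laplacian (homogeneous_extension u)"

definition dirichlet_eigenvalue :: "'a::euclidean_space set \<Rightarrow> real \<Rightarrow> bool"
  where "dirichlet_eigenvalue \<Sigma> \<mu> \<longleftrightarrow>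
    (\<exists>u. smooth_on (Cone \<Sigma>) (homogeneous_extension u) \<and>
         continuous_on (closure \<Sigma>) u \<and>
         (\<exists>\<theta>\<in>\<Sigma>. u \<theta> \<noteq> 0) \<and>
         (\<forall>\<theta>\<in>\<Sigma>. - laplace_beltrami u \<theta> = \<mu> * u \<theta>) \<and>
         (\<forall>\<theta>\<in>top_of_set (sphere 0 1) frontier_of \<Sigma>. u \<theta> = 0))"

definition first_dirichlet_eigenvalue :: "'a::euclidean_space set \<Rightarrow> real \<Rightarrow> bool"
  where "first_dirichlet_eigenvalue \<Sigma> \<mu> \<longleftrightarrow>
    dirichlet_eigenvalue \<Sigma> \<mu> \<and> (\<forall>\<nu>. dirichlet_eigenvalue \<Sigma> \<nu> \<longrightarrow> \<mu> \<le> \<nu>)"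

definition is_frequency :: "'a::euclidean_space set \<Rightarrow> real \<Rightarrow> bool"
  where "is_frequency \<Sigma> \<phi> \<longleftrightarrow>
    \<phi> > 0 \<and> (\<exists>\<mu>. first_dirichlet_eigenvalue \<Sigma> \<mu> \<and> \<phi> * (\<phi> + real DIM('a) - 2) = \<mu>)"

definition singular_dirichlet_solution ::
    "real \<Rightarrow> 'a::euclidean_space set \<Rightarrow> ('a \<Rightarrow> real) \<Rightarrow> bool"
  where "singular_dirichlet_solution \<gamma> \<Omega> U \<longleftrightarrow>
    smooth_on \<Omega> U \<and>
    continuous_on (closure \<Omega>) U \<and>
    (\<forall>x\<in>\<Omega>. U x > 0) \<and>
    (\<forall>x\<in>\<Omega>. - laplacian U x = U x powr (- \<gamma>)) \<and>
    (\<forall>x\<in>frontier \<Omega>. U x = 0)"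

definition p_seq :: "nat \<Rightarrow> (real ^ 'm) \<times> real"
  where "p_seq k = (16 powr (1 - real k) / 2) *\<^sub>R e_n"

definition a_seq :: "real \<Rightarrow> ((real ^ 'm) \<times> real \<Rightarrow> real) \<Rightarrow> nat \<Rightarrow> real"
  where "a_seq \<phi> U k = 16 powr (real k * \<phi>) * U (p_seq k)"

end

theory Submission
  imports Defs
begin

text \<open>
  Everything follows from the comparison principle: the right-hand side of the equation is
  decreasing in \<open>U\<close>, so a positive interior maximum of the difference of a subsolution and a
  supersolution is impossible. Because \<open>\<phi> (1 + \<gamma>) = 2\<close>, the rescaling
  \<open>V x = 16\<^sup>\<phi> U (x / 16)\<close> solves the same equation on \<open>\<Omega>\<close> with nonnegative boundary values, hence
  \<open>U \<le> V\<close>, which at \<open>p\<^sub>k\<close> is the monotonicity of \<open>a\<^sub>k\<close>. The supersolution \<open>2 - |x|\<^sup>2\<close> on \<open>\<Omega>\<close>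
  bounds \<open>U\<close> from above, and a small multiple of \<open>r\<^sup>2 - |x - p\<^sub>1|\<^sup>2\<close>, on a ball around \<open>p\<^sub>1\<close> whose
  radius \<open>r\<close> depends only on \<open>L\<close>, bounds \<open>U p\<^sub>1\<close> from below.
\<close>

section \<open>Laplacians given by explicit derivatives\<close>

text \<open>The derivatives are existential witnesses, so that rescalings and paraboloids are
  covered by derivative rules instead of evaluations of \<open>frechet_derivative\<close>, and
  \<open>l\<close> may be any expression agreeing with the trace of the Hessian on
  \<open>S\<close>.\<close>

definition has_laplacian_on ::
    "('a::euclidean_space \<Rightarrow> real) \<Rightarrow> ('a \<Rightarrow> real) \<Rightarrow> 'a set \<Rightarrow> bool"
  where "has_laplacian_on u l S \<longleftrightarrow>
    (\<exists>du ddu. (\<forall>x\<in>S. (u has_derivative du x) (at x)) \<and>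
      (\<forall>x\<in>S. \<forall>b\<in>Basis. ((\<lambda>y. du y b) has_derivative ddu b x) (at x)) \<and>
      (\<forall>x\<in>S. l x = (\<Sum>b\<in>Basis. ddu b x b)))"

lemma has_laplacian_on_subset:
  "has_laplacian_on u l S \<Longrightarrow> T \<subseteq> S \<Longrightarrow> has_laplacian_on u l T"
  unfolding has_laplacian_on_def by blast

lemma smooth_on_has_laplacian_on:
  fixes u :: "'a::euclidean_space \<Rightarrow> real"
  assumes "smooth_on S u"
  shows "has_laplacian_on u (laplacian u) S"
proof -
  have "Ck_on (Suc (Suc 0)) S u"
    using assms unfolding smooth_on_def by blast
  then have "\<forall>x\<in>S. u differentiable (at x)"
    "\<forall>v. \<forall>x\<in>S. (\<lambda>y. frechet_derivative u (at y) v) differentiable (at x)"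
    by auto
  then show ?thesis
    unfolding has_laplacian_on_def laplacian_def
    by (intro exI[of _ "\<lambda>x. frechet_derivative u (at x)"]
        exI[of _ "\<lambda>b x. frechet_derivative (\<lambda>y. frechet_derivative u (at y) b) (at x)"])
      (auto simp: frechet_derivative_works)
qed

text \<open>By the chain rule, each of the two differentiations brings out one factor
  \<open>s\<close>.\<close>

lemma has_laplacian_on_rescale:
  fixes u :: "'a::euclidean_space \<Rightarrow> real"
  assumes "has_laplacian_on u l S" and "\<And>x. x \<in> T \<Longrightarrow> s *\<^sub>R x \<in> S"
  shows "has_laplacian_on (\<lambda>x. c * u (s *\<^sub>R x)) (\<lambda>x. c * s\<^sup>2 * l (s *\<^sub>R x)) T"
proof -
  obtain du ddu where
    du [rule_format]: "\<forall>x\<in>S. (u has_derivative du x) (at x)" and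
    ddu [rule_format]: "\<forall>x\<in>S. \<forall>b\<in>Basis. ((\<lambda>y. du y b) has_derivative ddu b x) (at x)" and
    l [rule_format]: "\<forall>x\<in>S. l x = (\<Sum>b\<in>Basis. ddu b x b)"
    using assms(1) unfolding has_laplacian_on_def by blast
  have scale: "((\<lambda>x::'a. s *\<^sub>R x) has_derivative (\<lambda>h. s *\<^sub>R h)) (at x)" for x
    by (auto intro!: derivative_eq_intros)
  \<comment> \<open>The free factor \<open>k\<close> lets one rule serve twice: \<open>k = c\<close>
    for the first derivative, \<open>k = c * s\<close> for the second.\<close>
  have chain: "((\<lambda>x. k * f (s *\<^sub>R x)) has_derivative (\<lambda>h. k * s * f' h)) (at x)"
    if f: "(f has_derivative f') (at (s *\<^sub>R x))" for k x and f f' :: "'a \<Rightarrow> real"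
  proof -
    have "linear f'"
      using f has_derivative_linear by blast
    moreover have "((\<lambda>x. f (s *\<^sub>R x)) has_derivative (\<lambda>h. f' (s *\<^sub>R h))) (at x)"
      using has_derivative_compose[OF scale f] .
    ultimately show ?thesis
      using has_derivative_mult_right[of "\<lambda>x. f (s *\<^sub>R x)" _ _ k]
      by (simp add: linear_cmul mult.assoc)
  qed
  show ?thesis
    unfolding has_laplacian_on_def
  proof (intro exI conjI ballI)
    fix x assume "x \<in> T"
    then have x: "s *\<^sub>R x \<in> S"
      using assms(2) by blast
    show "((\<lambda>x. c * u (s *\<^sub>R x)) has_derivative (\<lambda>h. c * s * du (s *\<^sub>R x) h)) (at x)"
      using chain[OF du[OF x]] .
    show "((\<lambda>y. c * s * du (s *\<^sub>R y) b) has_derivative (\<lambda>h. c * s * s * ddu b (s *\<^sub>R x) h)) (at x)"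
      if "b \<in> Basis" for b
      using chain[OF ddu[OF x that]] .
    show "c * s\<^sup>2 * l (s *\<^sub>R x) = (\<Sum>b\<in>Basis. c * s * s * ddu b (s *\<^sub>R x) b)"
      by (simp add: l[OF x] sum_distrib_left power2_eq_square mult.assoc)
  qed
qed

text \<open>The barrier behind both bounds on \<open>U\<close>; its Hessian is
  \<open>- 2 * c\<close> times the identity.\<close>

lemma has_laplacian_on_paraboloid:
  fixes p :: "'a::euclidean_space"
  shows "has_laplacian_on (\<lambda>x. a - c * (norm (x - p))\<^sup>2) (\<lambda>x. - 2 * c * real DIM('a)) S"
  unfolding has_laplacian_on_def
proof (intro exI conjI ballI)
  fix x :: 'a
  show "((\<lambda>x. a - c * (norm (x - p))\<^sup>2) has_derivative (\<lambda>h. - 2 * c * ((x - p) \<bullet> h))) (at x)"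
    unfolding power2_norm_eq_inner
    by (auto intro!: derivative_eq_intros simp: inner_commute algebra_simps)
  show "((\<lambda>y. - 2 * c * ((y - p) \<bullet> b)) has_derivative (\<lambda>h. - 2 * c * (h \<bullet> b))) (at x)" for b
    by (auto intro!: derivative_eq_intros)
  show "- 2 * c * real DIM('a) = (\<Sum>b\<in>(Basis::'a set). - 2 * c * (b \<bullet> b))"
    by (simp add: inner_Basis)
qed

section \<open>Second derivative test and comparison principle\<close>

text \<open>If \<open>d\<close> were positive, \<open>h'\<close>, which vanishes at
  \<open>0\<close>, would be positive just to the right of \<open>0\<close>, and the mean value
  theorem would give \<open>h t > h 0\<close> for a small \<open>t > 0\<close>.\<close>

lemma second_derivative_nonpos_at_local_max:
  fixes h h' :: "real \<Rightarrow> real"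
  assumes "\<delta> > 0"
    and h: "\<And>t. \<bar>t\<bar> < \<delta> \<Longrightarrow> (h has_real_derivative h' t) (at t)"
    and h': "(h' has_real_derivative d) (at 0)"
    and max: "\<And>t. \<bar>t\<bar> < \<delta> \<Longrightarrow> h t \<le> h 0"
  shows "d \<le> 0"
proof (rule ccontr)
  assume "\<not> d \<le> 0"
  have "h' 0 = 0"
    using DERIV_local_max[OF h[of 0] \<open>\<delta> > 0\<close>] \<open>\<delta> > 0\<close> max by simp
  obtain e where "e > 0" and e: "\<And>t. 0 < t \<Longrightarrow> t < e \<Longrightarrow> h' t > 0"
    using DERIV_pos_inc_right[OF h'] \<open>\<not> d \<le> 0\<close> \<open>h' 0 = 0\<close> by auto
  define t where "t = min e \<delta> / 2"
  have t: "0 < t" "t < e" "t < \<delta>"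
    using \<open>e > 0\<close> \<open>\<delta> > 0\<close> by (auto simp: t_def min_def)
  obtain z where z: "0 < z" "z < t" "h t - h 0 = (t - 0) * h' z"
    using MVT2[OF t(1), of h h'] h t by auto
  then have "h t - h 0 > 0"
    using e t by simp
  then show False
    using max[of t] t by simp
qed

text \<open>At a maximum point \<open>z\<close> of \<open>u - v\<close> over the compact closure
  with \<open>v z < u z\<close>, the boundary condition forces \<open>z\<close> into
  \<open>S\<close>, and the second derivative test along each coordinate gives
  \<open>lu z \<le> lv z\<close>. The strict inequality in \<open>less\<close> contradicts this
  directly, with no perturbation of \<open>u\<close>.\<close>

lemma comparison_principle:
  fixes u v :: "'a::euclidean_space \<Rightarrow> real"
  assumes "open S" "bounded S"
    and cont: "continuous_on (closure S) u" "continuous_on (closure S) v"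
    and lap: "has_laplacian_on u lu S" "has_laplacian_on v lv S"
    and boundary: "\<And>x. x \<in> frontier S \<Longrightarrow> u x \<le> v x"
    and less: "\<And>x. x \<in> S \<Longrightarrow> v x < u x \<Longrightarrow> lv x < lu x"
    and "x \<in> S"
  shows "u x \<le> v x"
proof (rule ccontr)
  assume "\<not> u x \<le> v x"
  have "compact (closure S)" "closure S \<noteq> {}"
    using \<open>bounded S\<close> \<open>x \<in> S\<close> by auto
  moreover have "continuous_on (closure S) (\<lambda>y. u y - v y)"
    using cont by (intro continuous_intros)
  ultimately obtain z where "z \<in> closure S"
    and max: "\<And>y. y \<in> closure S \<Longrightarrow> u y - v y \<le> u z - v z"
    using continuous_attains_sup[of "closure S" "\<lambda>y. u y - v y"] by blast
  have "v z < u z"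
    using max[of x] \<open>x \<in> S\<close> \<open>\<not> u x \<le> v x\<close> closure_subset[of S] by auto
  then have "z \<in> S"
    using boundary[of z] \<open>z \<in> closure S\<close> \<open>open S\<close>
    by (force simp: frontier_def interior_open)
  then obtain \<delta> where "\<delta> > 0" and \<delta>: "ball z \<delta> \<subseteq> S"
    using \<open>open S\<close> openE by blast
  obtain du ddu where
    du [rule_format]: "\<forall>x\<in>S. (u has_derivative du x) (at x)" and
    ddu [rule_format]: "\<forall>x\<in>S. \<forall>b\<in>Basis. ((\<lambda>y. du y b) has_derivative ddu b x) (at x)" and
    lu [rule_format]: "\<forall>x\<in>S. lu x = (\<Sum>b\<in>Basis. ddu b x b)"
    using lap(1) unfolding has_laplacian_on_def by blast
  obtain dv ddv where
    dv [rule_format]: "\<forall>x\<in>S. (v has_derivative dv x) (at x)" and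
    ddv [rule_format]: "\<forall>x\<in>S. \<forall>b\<in>Basis. ((\<lambda>y. dv y b) has_derivative ddv b x) (at x)" and
    lv [rule_format]: "\<forall>x\<in>S. lv x = (\<Sum>b\<in>Basis. ddv b x b)"
    using lap(2) unfolding has_laplacian_on_def by blast
  \<comment> \<open>Restriction to a line through \<open>z\<close> reduces to one variable; it is
    applied to \<open>u\<close> and \<open>v\<close> and again to their partial derivatives.\<close>
  have line: "((\<lambda>t. f (z + t *\<^sub>R b)) has_real_derivative f' b) (at t)"
    if f: "(f has_derivative f') (at (z + t *\<^sub>R b))" for f :: "'a \<Rightarrow> real" and f' b t
  proof -
    have "((\<lambda>t. z + t *\<^sub>R b) has_derivative (\<lambda>h. h *\<^sub>R b)) (at t)"
      by (auto intro!: derivative_eq_intros)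
    from has_derivative_compose[OF this f]
    show ?thesis
      using linear_cmul[OF has_derivative_linear[OF f]]
      by (simp add: has_field_derivative_def mult.commute[of _ "f' b"])
  qed
  have "ddu b z b \<le> ddv b z b" if "b \<in> Basis" for b
  proof -
    have inS: "z + t *\<^sub>R b \<in> S" if "\<bar>t\<bar> < \<delta>" for t
      using that \<delta> \<open>b \<in> Basis\<close> by (auto simp: dist_norm subset_iff)
    have "ddu b z b - ddv b z b \<le> 0"
    proof (rule second_derivative_nonpos_at_local_max[OF \<open>\<delta> > 0\<close>])
      fix t :: real assume t: "\<bar>t\<bar> < \<delta>"
      show "((\<lambda>t. u (z + t *\<^sub>R b) - v (z + t *\<^sub>R b)) has_real_derivative
          du (z + t *\<^sub>R b) b - dv (z + t *\<^sub>R b) b) (at t)"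
        by (intro DERIV_diff line du dv inS t)
      show "u (z + t *\<^sub>R b) - v (z + t *\<^sub>R b) \<le> u (z + 0 *\<^sub>R b) - v (z + 0 *\<^sub>R b)"
        using max inS[OF t] closure_subset[of S] by auto
    next
      show "((\<lambda>t. du (z + t *\<^sub>R b) b - dv (z + t *\<^sub>R b) b) has_real_derivative
          ddu b z b - ddv b z b) (at 0)"
        using ddu[OF \<open>z \<in> S\<close> that] ddv[OF \<open>z \<in> S\<close> that]
        by (intro DERIV_diff line[where f = "\<lambda>y. du y b"] line[where f = "\<lambda>y. dv y b"]) auto
    qed
    then show ?thesis by simp
  qed
  then have "lu z \<le> lv z"
    unfolding lu[OF \<open>z \<in> S\<close>] lv[OF \<open>z \<in> S\<close>] by (rule sum_mono)
  then show False
    using less[OF \<open>z \<in> S\<close> \<open>v z < u z\<close>] by simp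
qed

lemma powr_neg_strict_antimono:
  fixes a b c :: real
  assumes "0 < a" "a < b" "0 < c"
  shows "b powr (- c) < a powr (- c)"
  using assms powr_less_mono2_neg[of "- c" a b] by simp

section \<open>A ball inside the cone, of radius controlled by \<open>L\<close>\<close>

text \<open>The annulus contains the unit sphere, where the sup norm bounds \<open>g\<close>;
  homogeneity carries the bound to every \<open>x\<close>.\<close>

lemma C01_norm_bounds_homogeneous:
  fixes g :: "'a::euclidean_space \<Rightarrow> real"
  assumes hom: "\<And>t x. t \<ge> 0 \<Longrightarrow> g (t *\<^sub>R x) = t * g x"
    and L: "C01_norm (ball 0 2 - ball 0 1) g = ereal L"
  shows "\<bar>g x\<bar> \<le> \<bar>L\<bar> * norm x"
proof (cases "x = 0")
  case True
  then show ?thesis using hom[of 0 x] by simp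
next
  case False
  let ?A = "ball 0 2 - ball 0 1 :: 'a set"
  define y where "y = x /\<^sub>R norm x"
  have "norm y = 1" using False by (simp add: y_def)
  \<comment> \<open>A supremum in \<open>ereal\<close> over the empty set is negative infinity, so
    nonnegativity of the Lipschitz seminorm needs two distinct points; \<open>y\<close> and
    \<open>- y\<close> are such a pair.\<close>
  then have "y \<in> ?A" "- y \<in> ?A" "y \<noteq> - y"
    by (auto simp: eq_neg_iff_add_eq_0 simp flip: scaleR_2)
  then have "ereal (norm (g y - g (- y)) / norm (y - (- y))) \<le> lip_seminorm ?A g"
    unfolding lip_seminorm_def by (intro Sup_upper) blast
  then have "0 \<le> lip_seminorm ?A g"
    by (rule order_trans[rotated]) simp
  moreover have "ereal \<bar>g y\<bar> \<le> sup_norm ?A g"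
    unfolding sup_norm_def using \<open>y \<in> ?A\<close> by (intro SUP_upper2[of y]) auto
  ultimately have "ereal \<bar>g y\<bar> + 0 \<le> ereal L"
    unfolding L[symmetric] C01_norm_def by (intro add_mono)
  then have "\<bar>g y\<bar> \<le> \<bar>L\<bar>" by simp
  moreover have "g x = norm x * g y"
    using hom[of "norm x" y] False by (simp add: y_def)
  ultimately show ?thesis
    using mult_right_mono[of "\<bar>g y\<bar>" "\<bar>L\<bar>" "norm x"] by (simp add: abs_mult mult.commute)
qed

text \<open>The radius solves \<open>r * (1 + \<bar>L\<bar>) = 1 / 2\<close>: over the ball,
  \<open>g\<close> is at most \<open>\<bar>L\<bar> * r = 1 / 2 - r\<close>, while
  \<open>x\<^sub>n\<close> exceeds \<open>1 / 2 - r\<close>. Since \<open>r \<le> 1 / 2\<close>, the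
  ball also stays in the unit ball.\<close>

lemma epigraphical_cone_contains_ball:
  assumes "C11_epigraphical_cone (\<Sigma> :: ((real ^ 'm) \<times> real) set) L K"
  shows "ball ((1 / 2) *\<^sub>R e_n) (1 / (2 * (1 + \<bar>L\<bar>))) \<subseteq> Cone \<Sigma> \<inter> ball 0 1"
proof
  obtain g :: "real ^ 'm \<Rightarrow> real" where
    cone: "Cone \<Sigma> = {(x', x\<^sub>n). x\<^sub>n > g x'}" and
    hom: "\<And>t x. t \<ge> 0 \<Longrightarrow> g (t *\<^sub>R x) = t * g x" and
    L: "C01_norm (ball 0 2 - ball 0 1) g = ereal L"
    using assms unfolding C11_epigraphical_cone_def by auto
  let ?p = "(1 / 2) *\<^sub>R e_n :: (real ^ 'm) \<times> real"
  define r where "r = 1 / (2 * (1 + \<bar>L\<bar>))"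
  have r: "r * (1 + \<bar>L\<bar>) = 1 / 2" by (simp add: r_def)
  have "r \<le> 1 / 2" by (simp add: r_def field_simps)
  fix x assume "x \<in> ball ?p (1 / (2 * (1 + \<bar>L\<bar>)))"
  then have x: "norm (x - ?p) < r" by (simp add: r_def dist_norm norm_minus_commute)
  obtain x' x\<^sub>n where x_eq: "x = (x', x\<^sub>n)" by (cases x)
  have "norm x' \<le> norm (x - ?p)" "\<bar>x\<^sub>n - 1 / 2\<bar> \<le> norm (x - ?p)"
    using norm_fst_le[of "x'" "x\<^sub>n - 1 / 2"] norm_snd_le[of "x\<^sub>n - 1 / 2" "x'"]
    by (simp_all add: x_eq e_n_def)
  then have x': "norm x' < r" and x\<^sub>n: "\<bar>x\<^sub>n - 1 / 2\<bar> < r"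
    using x by auto
  have "g x' \<le> \<bar>L\<bar> * norm x'"
    using C01_norm_bounds_homogeneous[OF hom L, of x'] by simp
  also have "\<dots> \<le> \<bar>L\<bar> * r"
    using x' by (intro mult_left_mono) auto
  also have "\<dots> = 1 / 2 - r"
    using r by (simp add: algebra_simps)
  also have "\<dots> < x\<^sub>n"
    using x\<^sub>n by linarith
  finally have "x \<in> Cone \<Sigma>"
    by (simp add: cone x_eq)
  moreover have "norm x < 1"
  proof -
    have "norm ?p = 1 / 2" by (simp add: e_n_def norm_Pair)
    then show ?thesis
      using norm_triangle_sub[of x ?p] x \<open>r \<le> 1 / 2\<close> by linarith
  qed
  ultimately show "x \<in> Cone \<Sigma> \<inter> ball 0 1" by simp
qed

lemma Cone_scaleR:
  assumes "x \<in> Cone \<Sigma>" "s > 0"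
  shows "s *\<^sub>R x \<in> Cone \<Sigma>"
proof -
  have "(s *\<^sub>R x) /\<^sub>R norm (s *\<^sub>R x) = x /\<^sub>R norm x"
    using assms(2) by (simp add: divide_simps)
  moreover have "s *\<^sub>R x \<noteq> 0"
    using assms by (simp add: Cone_def)
  ultimately show ?thesis
    using assms(1) unfolding Cone_def by (simp only: mem_Collect_eq) blast
qed

section \<open>Barriers and rescaling for the singular equation\<close>

text \<open>At a point of \<open>\<Omega>\<close> on its own frontier, \<open>U\<close> would be
  both positive and zero.\<close>

lemma singular_dirichlet_solution_open:
  assumes "singular_dirichlet_solution \<gamma> \<Omega> U"
  shows "open \<Omega>"
proof -
  have "\<Omega> \<inter> frontier \<Omega> = {}"
    using assms unfolding singular_dirichlet_solution_def by force
  then show ?thesis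
    by (metis Int_commute frontier_disjoint_eq)
qed

lemma singular_dirichlet_solution_nonneg:
  assumes "singular_dirichlet_solution \<gamma> \<Omega> U" "x \<in> closure \<Omega>"
  shows "U x \<ge> 0"
proof (cases "x \<in> \<Omega>")
  case True
  then show ?thesis
    using assms unfolding singular_dirichlet_solution_def by force
next
  case False
  then have "x \<in> frontier \<Omega>"
    using assms(2) interior_subset[of \<Omega>] by (auto simp: frontier_def)
  then show ?thesis
    using assms unfolding singular_dirichlet_solution_def by simp
qed

text \<open>The barrier is at least \<open>1\<close> on the unit ball. Where \<open>U\<close>
  exceeds it, \<open>U > 1\<close> and \<open>- laplacian U < 1\<close>, whereas minus the Laplacian
  of the barrier is twice the dimension.\<close>

lemma singular_dirichlet_solution_upper_bound:
  fixes \<Omega> :: "'a::euclidean_space set"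
  assumes U: "singular_dirichlet_solution \<gamma> \<Omega> U" and "\<gamma> > 0" "\<Omega> \<subseteq> ball 0 1" "x \<in> \<Omega>"
  shows "U x \<le> 2"
proof -
  have norm: "(norm y)\<^sup>2 \<le> 1" if "y \<in> closure \<Omega>" for y
    using that closure_mono[OF \<open>\<Omega> \<subseteq> ball 0 1\<close>] by (auto simp: subset_iff power_le_one)
  \<comment> \<open>The factor \<open>1\<close> and the shift by \<open>0\<close> keep the syntactic
    shape of \<open>has_laplacian_on_paraboloid\<close>.\<close>
  have "U x \<le> 2 - 1 * (norm (x - 0))\<^sup>2"
  proof (rule comparison_principle[OF singular_dirichlet_solution_open[OF U] _ _ _ _
        has_laplacian_on_paraboloid _ _ \<open>x \<in> \<Omega>\<close>])
    show "bounded \<Omega>"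
      using \<open>\<Omega> \<subseteq> ball 0 1\<close> bounded_ball bounded_subset by blast
    show "continuous_on (closure \<Omega>) U" "has_laplacian_on U (laplacian U) \<Omega>"
      using U smooth_on_has_laplacian_on unfolding singular_dirichlet_solution_def by blast+
    show "continuous_on (closure \<Omega>) (\<lambda>x. 2 - 1 * (norm (x - 0))\<^sup>2)"
      by (intro continuous_intros)
    show "U y \<le> 2 - 1 * (norm (y - 0))\<^sup>2" if "y \<in> frontier \<Omega>" for y
      using that U norm[of y] unfolding singular_dirichlet_solution_def
      by (auto simp: frontier_def)
    show "- 2 * 1 * real DIM('a) < laplacian U y"
      if "y \<in> \<Omega>" "2 - 1 * (norm (y - 0))\<^sup>2 < U y" for y
    proof -
      have "1 < U y"
        using that norm[of y] closure_subset[of \<Omega>] by auto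
      then have "U y powr (- \<gamma>) < 1"
        using powr_neg_strict_antimono[of 1 "U y" \<gamma>] \<open>\<gamma> > 0\<close> by simp
      moreover have "real DIM('a) \<ge> 1"
        using DIM_positive[where 'a = 'a] by linarith
      moreover have "- laplacian U y = U y powr (- \<gamma>)"
        using U \<open>y \<in> \<Omega>\<close> unfolding singular_dirichlet_solution_def by blast
      ultimately show ?thesis by linarith
    qed
  qed
  also have "\<dots> \<le> 2" by simp
  finally show ?thesis .
qed

text \<open>The paraboloid vanishes on the sphere around \<open>p\<close>, where
  \<open>U \<ge> 0\<close> even if the sphere touches the frontier of \<open>\<Omega>\<close>. Where
  \<open>U\<close> is below it, \<open>U < \<epsilon> * r\<^sup>2\<close>, so the condition on
  \<epsilon> makes \<open>- laplacian U\<close> exceed \<open>2 * \<epsilon> * DIM('a)\<close>. The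
  claim is the comparison at the centre.\<close>

lemma singular_dirichlet_solution_lower_bound:
  fixes \<Omega> :: "'a::euclidean_space set"
  assumes U: "singular_dirichlet_solution \<gamma> \<Omega> U" and "\<gamma> > 0" "0 < r" "ball p r \<subseteq> \<Omega>"
    and \<epsilon>: "\<epsilon> > 0" "2 * \<epsilon> * real DIM('a) \<le> (\<epsilon> * r\<^sup>2) powr (- \<gamma>)"
  shows "\<epsilon> * r\<^sup>2 \<le> U p"
proof -
  let ?w = "\<lambda>x. \<epsilon> * r\<^sup>2 - \<epsilon> * (norm (x - p))\<^sup>2"
  have sub: "closure (ball p r) \<subseteq> closure \<Omega>"
    using \<open>ball p r \<subseteq> \<Omega>\<close> by (rule closure_mono)
  have "?w p \<le> U p"
  proof (rule comparison_principle[where S = "ball p r" and v = U and lv = "laplacian U",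
        OF open_ball bounded_ball _ _ has_laplacian_on_paraboloid])
    show "p \<in> ball p r" using \<open>0 < r\<close> by simp
    show "continuous_on (closure (ball p r)) ?w"
      by (intro continuous_intros)
    show "continuous_on (closure (ball p r)) U"
      using U sub continuous_on_subset unfolding singular_dirichlet_solution_def by blast
    show "has_laplacian_on U (laplacian U) (ball p r)"
      using U \<open>ball p r \<subseteq> \<Omega>\<close> smooth_on_has_laplacian_on has_laplacian_on_subset
      unfolding singular_dirichlet_solution_def by blast
    show "?w y \<le> U y" if "y \<in> frontier (ball p r)" for y
    proof -
      have "norm (y - p) = r"
        using that \<open>0 < r\<close> by (simp add: dist_norm norm_minus_commute)
      moreover have "y \<in> closure \<Omega>"
        using that sub by (auto simp: frontier_def)
      ultimately show ?thesis
        using singular_dirichlet_solution_nonneg[OF U] by simp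
    qed
    show "laplacian U y < - 2 * \<epsilon> * real DIM('a)" if "y \<in> ball p r" "U y < ?w y" for y
    proof -
      have y: "- laplacian U y = U y powr (- \<gamma>)" "U y > 0"
        using U that \<open>ball p r \<subseteq> \<Omega>\<close> unfolding singular_dirichlet_solution_def by blast+
      have "0 \<le> \<epsilon> * (norm (y - p))\<^sup>2" using \<epsilon> by simp
      then have "U y < \<epsilon> * r\<^sup>2"
        using that by linarith
      then show ?thesis
        using powr_neg_strict_antimono[of "U y" "\<epsilon> * r\<^sup>2" \<gamma>] y \<open>\<gamma> > 0\<close> \<epsilon> by linarith
    qed
  qed
  then show ?thesis by simp
qed

text \<open>By \<open>star\<close>, \<open>c * U (s *\<^sub>R x)\<close> is defined and positive on
  \<open>\<Omega>\<close>; it solves the same equation and is nonnegative on the frontier, where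
  \<open>U\<close> vanishes.\<close>

lemma singular_dirichlet_solution_le_rescaling:
  fixes \<Omega> :: "'a::euclidean_space set"
  assumes U: "singular_dirichlet_solution \<gamma> \<Omega> U" and "\<gamma> > 0" "bounded \<Omega>" "x \<in> \<Omega>"
    and star: "\<And>y. y \<in> \<Omega> \<Longrightarrow> s *\<^sub>R y \<in> \<Omega>" and "s > 0"
  shows "U x \<le> s powr (- (2 / (1 + \<gamma>))) * U (s *\<^sub>R x)"
proof -
  define c where "c = s powr (- (2 / (1 + \<gamma>)))"
  have "c > 0" using \<open>s > 0\<close> by (simp add: c_def)
  \<comment> \<open>This identity fixes the exponent in \<open>c\<close>: it amounts to
    \<open>c powr (1 + \<gamma>) = s powr (- 2)\<close> and makes the equation invariant under the
    rescaling.\<close>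
  have scaling: "c * s\<^sup>2 = c powr (- \<gamma>)"
  proof -
    have "c * s\<^sup>2 = s powr (2 - 2 / (1 + \<gamma>))"
      using \<open>s > 0\<close> by (simp add: c_def powr_add[symmetric] flip: powr_numeral)
    also have "2 - 2 / (1 + \<gamma>) = - (2 / (1 + \<gamma>)) * (- \<gamma>)"
      using \<open>\<gamma> > 0\<close> by (simp add: field_simps)
    finally show ?thesis by (simp only: c_def powr_powr)
  qed
  have sub: "s *\<^sub>R y \<in> closure \<Omega>" if "y \<in> closure \<Omega>" for y
    using that star closure_scaleR[of s \<Omega>] closure_mono[of "(*\<^sub>R) s ` \<Omega>" \<Omega>] by blast
  have cont: "continuous_on (closure \<Omega>) U" and lap: "has_laplacian_on U (laplacian U) \<Omega>"
    using U smooth_on_has_laplacian_on unfolding singular_dirichlet_solution_def by blast+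
  have "U x \<le> c * U (s *\<^sub>R x)"
  proof (rule comparison_principle[OF singular_dirichlet_solution_open[OF U] \<open>bounded \<Omega>\<close>
        cont _ lap has_laplacian_on_rescale[OF lap star] _ _ \<open>x \<in> \<Omega>\<close>])
    show "continuous_on (closure \<Omega>) (\<lambda>x. c * U (s *\<^sub>R x))"
      using sub by (intro continuous_intros continuous_on_compose2[OF cont]) auto
    show "U y \<le> c * U (s *\<^sub>R y)" if "y \<in> frontier \<Omega>" for y
    proof -
      have "U y = 0"
        using U that unfolding singular_dirichlet_solution_def by blast
      moreover have "U (s *\<^sub>R y) \<ge> 0"
        using singular_dirichlet_solution_nonneg[OF U] sub that by (simp add: frontier_def)
      ultimately show ?thesis using \<open>c > 0\<close> by simp
    qed
    show "c * s\<^sup>2 * laplacian U (s *\<^sub>R y) < laplacian U y"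
      if "y \<in> \<Omega>" and less: "c * U (s *\<^sub>R y) < U y" for y
    proof -
      have y: "- laplacian U y = U y powr (- \<gamma>)"
        "- laplacian U (s *\<^sub>R y) = U (s *\<^sub>R y) powr (- \<gamma>)" "U (s *\<^sub>R y) > 0"
        using U \<open>y \<in> \<Omega>\<close> star[OF \<open>y \<in> \<Omega>\<close>] unfolding singular_dirichlet_solution_def by blast+
      have "- (c * s\<^sup>2 * laplacian U (s *\<^sub>R y)) = c powr (- \<gamma>) * U (s *\<^sub>R y) powr (- \<gamma>)"
        by (simp add: scaling flip: y(2))
      also have "\<dots> = (c * U (s *\<^sub>R y)) powr (- \<gamma>)"
        using \<open>c > 0\<close> y(3) by (simp add: powr_mult)
      also have "\<dots> > U y powr (- \<gamma>)"
        using powr_neg_strict_antimono[OF _ less \<open>\<gamma> > 0\<close>] mult_pos_pos[OF \<open>c > 0\<close> y(3)] by blast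
      finally show ?thesis using y by linarith
    qed
  qed
  then show ?thesis by (simp add: c_def)
qed

section \<open>Uniform constants and monotonicity of \<open>a_seq\<close>\<close>

text \<open>Both sides are compared with \<open>1\<close>: the first entry of the minimum bounds the
  left side by \<open>1\<close>, the second gives \<open>\<epsilon> * r\<^sup>2 \<le> 1\<close>,
  whose negative power is at least \<open>1\<close>.\<close>

lemma small_barrier_height_exists:
  fixes \<gamma> r N :: real
  assumes "\<gamma> > 0" "r > 0" "N > 0"
  obtains \<epsilon> where "\<epsilon> > 0" "2 * \<epsilon> * N \<le> (\<epsilon> * r\<^sup>2) powr (- \<gamma>)"
proof
  let ?\<epsilon> = "min (1 / (2 * N)) (1 / r\<^sup>2)"
  show "?\<epsilon> > 0" using assms by simp
  have "2 * ?\<epsilon> * N \<le> 2 * (1 / (2 * N)) * N"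
    using assms by (intro mult_right_mono mult_left_mono) auto
  also have "\<dots> = 1" using assms by simp
  also have "1 \<le> (?\<epsilon> * r\<^sup>2) powr (- \<gamma>)"
  proof -
    have "?\<epsilon> * r\<^sup>2 \<le> 1 / r\<^sup>2 * r\<^sup>2"
      by (intro mult_right_mono) auto
    then have "?\<epsilon> * r\<^sup>2 \<le> 1" using assms by simp
    moreover have "?\<epsilon> * r\<^sup>2 > 0" using \<open>?\<epsilon> > 0\<close> assms by simp
    ultimately show ?thesis
      using powr_mono2'[of "- \<gamma>" "?\<epsilon> * r\<^sup>2" 1] assms by simp
  qed
  finally show "2 * ?\<epsilon> * N \<le> (?\<epsilon> * r\<^sup>2) powr (- \<gamma>)" .
qed

theorem lemma3p1:
  fixes \<gamma> L K :: real
  assumes "\<gamma> > 0"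
  shows "\<exists>C>0. \<forall>(\<Sigma> :: ((real ^ 'm) \<times> real) set) (\<phi> :: real) (U :: (real ^ 'm) \<times> real \<Rightarrow> real).
    C11_epigraphical_cone \<Sigma> L K \<longrightarrow>
    is_frequency \<Sigma> \<phi> \<longrightarrow>
    \<phi> = 2 / (1 + \<gamma>) \<longrightarrow>
    singular_dirichlet_solution \<gamma> (Cone \<Sigma> \<inter> ball 0 1) U \<longrightarrow>
    (inverse C \<le> a_seq \<phi> U 1 \<and> a_seq \<phi> U 1 \<le> C) \<and>
    (\<forall>k\<ge>1. a_seq \<phi> U (k + 1) \<ge> a_seq \<phi> U k)"
proof -
  \<comment> \<open>All constants are fixed before any cone or solution is considered, from the
    dimension, \<gamma> and \<open>L\<close>.\<close>
  define r where "r = 1 / (2 * (1 + \<bar>L\<bar>))"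
  have "r > 0" by (simp add: r_def)
  obtain \<epsilon> where \<epsilon>: "\<epsilon> > 0"
    "2 * \<epsilon> * real DIM((real ^ 'm) \<times> real) \<le> (\<epsilon> * r\<^sup>2) powr (- \<gamma>)"
    using small_barrier_height_exists[OF \<open>\<gamma> > 0\<close> \<open>r > 0\<close>, of "real DIM((real ^ 'm) \<times> real)"]
    by auto
  define q where "q = 16 powr (2 / (1 + \<gamma>))"
  \<comment> \<open>With \<open>q\<close> equal to 16 to the power \<phi>, the entries come from
    \<open>U \<le> 2\<close> and from the barrier height \<open>\<epsilon> * r\<^sup>2\<close> at
    the first point.\<close>
  define C where "C = max (2 * q) (inverse (q * (\<epsilon> * r\<^sup>2)))"
  have "q > 0" by (simp add: q_def)
  then have "C > 0" by (simp add: C_def less_max_iff_disj)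
  have lower: "inverse C \<le> q * (\<epsilon> * r\<^sup>2)"
  proof -
    have "q * (\<epsilon> * r\<^sup>2) > 0" using \<open>q > 0\<close> \<epsilon> \<open>r > 0\<close> by simp
    then have "inverse C \<le> inverse (inverse (q * (\<epsilon> * r\<^sup>2)))"
      by (intro le_imp_inverse_le positive_imp_inverse_positive) (auto simp: C_def)
    then show ?thesis by simp
  qed
  have bounds: "(inverse C \<le> a_seq \<phi> U 1 \<and> a_seq \<phi> U 1 \<le> C) \<and>
      (\<forall>k\<ge>1. a_seq \<phi> U (k + 1) \<ge> a_seq \<phi> U k)"
    if cone: "C11_epigraphical_cone \<Sigma> L K" and \<phi>: "\<phi> = 2 / (1 + \<gamma>)"
      and U: "singular_dirichlet_solution \<gamma> (Cone \<Sigma> \<inter> ball 0 1) U"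
    for \<Sigma> :: "((real ^ 'm) \<times> real) set" and \<phi> U
  proof -
    let ?\<Omega> = "Cone \<Sigma> \<inter> ball 0 1"
    let ?p = "(1 / 2) *\<^sub>R e_n :: (real ^ 'm) \<times> real"
    have ball: "ball ?p r \<subseteq> ?\<Omega>"
      unfolding r_def using epigraphical_cone_contains_ball[OF cone] .
    have shrink: "s *\<^sub>R x \<in> ?\<Omega>" if "x \<in> ?\<Omega>" "0 < s" "s \<le> 1" for x s
    proof -
      have "s * norm x \<le> 1 * norm x"
        using that by (intro mult_right_mono) auto
      then show ?thesis
        using that Cone_scaleR[of x \<Sigma> s] by auto
    qed
    have a1: "a_seq \<phi> U 1 = q * U ?p"
      by (simp add: a_seq_def p_seq_def q_def \<phi>)
    have "\<epsilon> * r\<^sup>2 \<le> U ?p"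
      using singular_dirichlet_solution_lower_bound[OF U \<open>\<gamma> > 0\<close> \<open>r > 0\<close> ball \<epsilon>] .
    then have "inverse C \<le> a_seq \<phi> U 1"
      using lower mult_left_mono[of "\<epsilon> * r\<^sup>2" "U ?p" q] \<open>q > 0\<close> unfolding a1 by linarith
    moreover have "a_seq \<phi> U 1 \<le> C"
    proof -
      have "?p \<in> ?\<Omega>" using ball \<open>r > 0\<close> by (meson centre_in_ball subsetD)
      then have "U ?p \<le> 2"
        by (intro singular_dirichlet_solution_upper_bound[OF U \<open>\<gamma> > 0\<close>]) auto
      then show ?thesis
        using mult_left_mono[of "U ?p" 2 q] \<open>q > 0\<close> unfolding a1 C_def by linarith
    qed
    moreover have "a_seq \<phi> U k \<le> a_seq \<phi> U (k + 1)" if "k \<ge> 1" for k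
    proof -
      have "?p \<in> ?\<Omega>" using ball \<open>r > 0\<close> by (meson centre_in_ball subsetD)
      \<comment> \<open>Here \<open>k \<ge> 1\<close> enters: \<open>p_seq k\<close> is a
        contraction of \<open>?p\<close> towards the apex and so stays in the domain.\<close>
      moreover have "16 powr (1 - real k) \<le> 16 powr 0"
        using that by (intro powr_mono) auto
      ultimately have "16 powr (1 - real k) *\<^sub>R ?p \<in> ?\<Omega>"
        using shrink[of ?p "16 powr (1 - real k)"] by simp
      then have "p_seq k \<in> ?\<Omega>"
        by (simp add: p_seq_def)
      \<comment> \<open>Rescaling by \<open>s = 1 / 16\<close> maps \<open>p_seq k\<close> to
        \<open>p_seq (k + 1)\<close>, and its factor is exactly the ratio of consecutive weights in
        \<open>a_seq\<close>.\<close>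
      then have "U (p_seq k) \<le> (1 / 16) powr (- (2 / (1 + \<gamma>))) * U ((1 / 16) *\<^sub>R p_seq k)"
        using shrink[where s = "1 / 16"]
        by (intro singular_dirichlet_solution_le_rescaling[OF U \<open>\<gamma> > 0\<close>]) auto
      moreover have "(1 / 16 :: real) powr (- (2 / (1 + \<gamma>))) = 16 powr \<phi>"
        by (simp add: \<phi> powr_divide powr_minus_divide)
      moreover have "(1 / 16) *\<^sub>R p_seq k = (p_seq (k + 1) :: (real ^ 'm) \<times> real)"
        by (simp add: p_seq_def powr_diff powr_minus_divide)
      ultimately have "16 powr (real k * \<phi>) * U (p_seq k) \<le>
          16 powr (real k * \<phi>) * (16 powr \<phi> * U (p_seq (k + 1)))"
        by (intro mult_left_mono) auto
      moreover have "16 powr (real (k + 1) * \<phi>) = 16 powr (real k * \<phi>) * 16 powr \<phi>"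
        by (simp add: powr_add[symmetric] algebra_simps)
      ultimately show ?thesis
        by (simp only: a_seq_def mult.assoc)
    qed
    ultimately show ?thesis by blast
  qed
  then show ?thesis
    using \<open>C > 0\<close> by blast
qed

end
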